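(* Let $\mathbb{D}^2=\{z\in\mathbb{C} : |z|<1\}$ be the open unit disk. The Apollonian weak metric $\delta_{\mathbb{D}^2}$ of $\mathbb{D}^2$ is given, for all $x,y\in\mathbb{D}^2$, by $$\delta_{\mathbb{D}^2}(x,y)=\log\left(\frac{|x-y|+|x\overline{y}-1|}{\left|1-|y|^2\right|}\right).$$
   Context: For the open unit disk $\mathbb{D}^2\subset\mathbb{C}$, with boundary the unit circle $\mathbb{S}^1=\{a\in\mathbb{C}:|a|=1\}$, the Apollonian weak metric is the function $\delta_{\mathbb{D}^2}:\mathbb{D}^2\times\mathbb{D}^2\to[0,\infty)$ defined by $\delta_{\mathbb{D}^2}(x,y)=\sup_{a\in\mathbb{S}^1}\log\frac{|x-a|}{|y-a|}$. *)

theory Defs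
  imports "HOL-Analysis.Analysis"
begin

(* The supremum is taken in the conditionally complete lattice of reals; it is
   meaningful for x and y in the open disk ball 0 1, where the logarithm is
   continuous in a on the compact circle, hence bounded. *)
definition apollonian_disk :: "complex \<Rightarrow> complex \<Rightarrow> real" where
  "apollonian_disk x y = (SUP a\<in>sphere 0 1. ln (cmod (x - a) / cmod (y - a)))"

end

theory Submission
  imports Defs
begin

text \<open>For \<open>\<bar>a\<bar> = 1\<close> the identity
  \<open>(1 - \<bar>y\<bar>\<^sup>2) (x - a) = (1 - x cnj y) (y - a) + (x - y) (1 - a cnj y)\<close>
  together with \<open>\<bar>1 - a cnj y\<bar> = \<bar>y - a\<bar>\<close> bounds \<open>\<bar>x - a\<bar> / \<bar>y - a\<bar>\<close> by the triangle inequality.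
  As \<open>a\<close> runs over the circle, the quotient \<open>(1 - a cnj y) / (y - a)\<close> takes every unimodular value,
  in particular the one that aligns the two summands, so the bound is attained.\<close>

lemma disk_boundary_identity:
  fixes x y a :: complex
  shows "of_real (1 - (cmod y)\<^sup>2) * (x - a) = (1 - x * cnj y) * (y - a) + (x - y) * (1 - a * cnj y)"
proof -
  have "complex_of_real (1 - (cmod y)\<^sup>2) = 1 - y * cnj y"
    using complex_norm_square[of y] by simp
  then show ?thesis
    by (simp add: algebra_simps)
qed

text \<open>On the circle \<open>1 = a * cnj a\<close>, so a unimodular factor \<open>a\<close> can
  be pulled out, leaving the conjugate of \<open>a - y\<close>.\<close>

lemma cmod_one_minus_mult_cnj:
  fixes y a :: complex
  assumes "cmod a = 1"
  shows "cmod (1 - a * cnj y) = cmod (y - a)"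
proof -
  have "a * cnj a = 1"
    using assms complex_norm_square[of a] by simp
  then have "1 - a * cnj y = a * cnj (a - y)"
    by (simp add: algebra_simps)
  then show ?thesis
    using assms by (simp only: norm_mult complex_mod_cnj) (simp add: norm_minus_commute)
qed

lemma disk_boundary_quotient_surj:
  fixes y w :: complex
  assumes y: "cmod y < 1" and w: "cmod w = 1"
  obtains a where "cmod a = 1" "1 - a * cnj y = w * (y - a)"
proof
  \<comment> \<open>The required equation is linear in \<open>a\<close>; this is its
    solution.\<close>
  define a where "a = (1 - w * y) / (cnj y - w)"
  have ne: "cnj y - w \<noteq> 0"
    using y w by auto
  \<comment> \<open>The modulus lemma applies with \<open>w\<close> as the boundary point and
    \<open>cnj y\<close> as the interior point.\<close>
  have "cmod (1 - w * y) = cmod (cnj y - w)"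
    using cmod_one_minus_mult_cnj[OF w, of "cnj y"] by simp
  with ne show "cmod a = 1"
    by (simp add: a_def norm_divide)
  from ne have "a * (cnj y - w) = 1 - w * y"
    by (simp add: a_def)
  then show "1 - a * cnj y = w * (y - a)"
    by (simp add: algebra_simps)
qed

lemma unimodular_alignment:
  fixes A B :: complex
  obtains w where "cmod w = 1" "cmod (A + B * w) = cmod A + cmod B"
proof (cases "A = 0 \<or> B = 0")
  case True
  then show ?thesis
    using that[of 1] by auto
next
  case False
  \<comment> \<open>This \<open>w\<close> rotates \<open>B\<close> onto the ray through
    \<open>A\<close>, so that \<open>B * w\<close> equals \<open>cmod B\<close> times
    \<open>sgn A\<close>.\<close>
  define w where "w = sgn A / sgn B"
  from False have "cmod w = 1"
    by (simp add: w_def norm_divide norm_sgn)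
  moreover have "A + B * w = of_real (cmod A + cmod B) * sgn A"
    using False by (simp add: w_def sgn_eq field_simps)
  then have "cmod (A + B * w) = cmod A + cmod B"
    using False by (simp only: norm_mult norm_of_real) (simp add: norm_sgn)
  ultimately show ?thesis
    using that by blast
qed

theorem theorem2:
  fixes x y :: complex
  assumes "x \<in> ball 0 1" and "y \<in> ball 0 1"
  shows "apollonian_disk x y =
    ln ((cmod (x - y) + cmod (x * cnj y - 1)) / \<bar>1 - (cmod y)\<^sup>2\<bar>)"
proof -
  let ?M = "(cmod (x - y) + cmod (x * cnj y - 1)) / \<bar>1 - (cmod y)\<^sup>2\<bar>"
  have x: "cmod x < 1" and y: "cmod y < 1"
    using assms by auto
  then have pos: "1 - (cmod y)\<^sup>2 > 0"
    by (simp add: power_less_one_iff)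
  have scaled: "cmod (x - a) * \<bar>1 - (cmod y)\<^sup>2\<bar> =
      cmod ((1 - x * cnj y) * (y - a) + (x - y) * (1 - a * cnj y))" for a
    using disk_boundary_identity[of y x a] by (metis mult.commute norm_mult norm_of_real)
  have A: "cmod (1 - x * cnj y) = cmod (x * cnj y - 1)"
    by (rule norm_minus_commute)
  have off_circle: "cmod (x - a) > 0" "cmod (y - a) > 0" if "cmod a = 1" for a
    using that x y by auto
  have le: "cmod (x - a) / cmod (y - a) \<le> ?M" if a: "cmod a = 1" for a
  proof -
    \<comment> \<open>Both summands of the identity contribute the same factor
      \<open>cmod (y - a)\<close>, which then cancels against the denominator.\<close>
    have "cmod (x - a) * \<bar>1 - (cmod y)\<^sup>2\<bar>
        \<le> cmod (x * cnj y - 1) * cmod (y - a) + cmod (x - y) * cmod (y - a)"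
      unfolding scaled using norm_triangle_ineq
      by (metis A norm_mult cmod_one_minus_mult_cnj[OF a])
    then show ?thesis
      using off_circle[OF a] pos by (simp add: field_simps)
  qed
  obtain w where w: "cmod w = 1"
    and align: "cmod ((1 - x * cnj y) + (x - y) * w) = cmod (1 - x * cnj y) + cmod (x - y)"
    by (rule unimodular_alignment)
  obtain a where a: "cmod a = 1" and aw: "1 - a * cnj y = w * (y - a)"
    using disk_boundary_quotient_surj[OF y w] .
  \<comment> \<open>For this \<open>a\<close> the factor \<open>y - a\<close> splits off exactly,
    leaving the aligned sum, for which the triangle inequality is an equality.\<close>
  have "(1 - x * cnj y) * (y - a) + (x - y) * (1 - a * cnj y)
      = ((1 - x * cnj y) + (x - y) * w) * (y - a)"
    unfolding aw by (simp add: algebra_simps)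
  then have "cmod (x - a) * \<bar>1 - (cmod y)\<^sup>2\<bar>
      = (cmod (x * cnj y - 1) + cmod (x - y)) * cmod (y - a)"
    using scaled[of a] align A by (simp only: norm_mult)
  then have attained: "cmod (x - a) / cmod (y - a) = ?M"
    using off_circle[OF a] pos by (simp add: field_simps)
  show ?thesis
    unfolding apollonian_disk_def
  \<comment> \<open>The supremum is a maximum, attained at \<open>a\<close>, so boundedness of the
    set needs no separate argument.\<close>
  proof (rule cSup_eq_maximum)
    show "ln ?M \<in> (\<lambda>a. ln (cmod (x - a) / cmod (y - a))) ` sphere 0 1"
      using a attained by (intro image_eqI[of _ _ a]) auto
  next
    fix t
    assume "t \<in> (\<lambda>a. ln (cmod (x - a) / cmod (y - a))) ` sphere 0 1"
    then obtain b where b: "cmod b = 1" and t: "t = ln (cmod (x - b) / cmod (y - b))"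
      by auto
    show "t \<le> ln ?M"
      unfolding t using le[OF b] off_circle[OF b] by (intro ln_mono) auto
  qed
qed

end
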